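(* Let $d\ge 1$ and let $\Omega\subset\mathbb{R}^d$ be a bounded open set. The partition function is invariant under the parabolic dilations $(x,t)\mapsto(\rho x,\rho^2 t)$, $\rho>0$; that is, for every $\rho>0$ and every $t>0$, $$Z_{\rho\Omega}(\rho^2 t)=Z_{\Omega}(t),\qquad \rho\Omega=\{\rho x: x\in\Omega\}.$$
   Context: For a bounded open set $\Omega\subset\mathbb{R}^d$, $\Delta_D$ denotes the Dirichlet Laplacian on $\Omega$ and $p_t(x,y)$ the Dirichlet heat kernel, i.e. the integral kernel of $e^{t\Delta_D}$ on $L^2(\Omega)$ (diffusion constant one). The (Dirichlet) partition function is $Z_\Omega(t)=\mathrm{Tr}(e^{t\Delta_D})=\int_\Omega p_t(x,x)\,dx=\sum_{m\ge 1}e^{-\lambda_m t}$, $t>0$, where $\lambda_1\le\lambda_2\le\dots$ are the eigenvalues of $-\Delta_D$ counted with multiplicity. *)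

theory Defs
  imports "HOL-Analysis.Analysis"
begin

section \<open>The Hilbert space of square-integrable functions\<close>

definition square_integrable :: "('a::euclidean_space \<Rightarrow> 'b::euclidean_space) \<Rightarrow> bool" where
  "square_integrable f \<longleftrightarrow> f \<in> borel_measurable lborel \<and> integrable lborel (\<lambda>x. (norm (f x))\<^sup>2)"

lemma square_integrable_zero: "square_integrable (\<lambda>x. 0)"
  by (simp add: square_integrable_def)

lemma square_integrable_add:
  assumes "square_integrable f" "square_integrable g"
  shows "square_integrable (\<lambda>x. f x + g x)"
proof -
  have [measurable]: "f \<in> borel_measurable borel" "g \<in> borel_measurable borel"
    using assms by (simp_all add: square_integrable_def)
  have *: "(norm (f x + g x))\<^sup>2 \<le> 2 * (norm (f x))\<^sup>2 + 2 * (norm (g x))\<^sup>2" for x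
  proof -
    have "(norm (f x + g x))\<^sup>2 \<le> (norm (f x) + norm (g x))\<^sup>2"
      by (intro power_mono norm_triangle_ineq) auto
    also have "\<dots> \<le> 2 * (norm (f x))\<^sup>2 + 2 * (norm (g x))\<^sup>2"
      using sum_squares_bound[of "norm (f x)" "norm (g x)"] by (simp add: power2_sum)
    finally show ?thesis .
  qed
  have "integrable lborel (\<lambda>x. 2 * (norm (f x))\<^sup>2 + 2 * (norm (g x))\<^sup>2)"
    using assms by (simp add: square_integrable_def)
  then have "integrable lborel (\<lambda>x. (norm (f x + g x))\<^sup>2)"
    by (rule Bochner_Integration.integrable_bound) (use * in auto)
  then show ?thesis
    by (simp add: square_integrable_def)
qed

lemma square_integrable_scaleR:
  assumes "square_integrable f"
  shows "square_integrable (\<lambda>x. c *\<^sub>R f x)"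
proof -
  have [measurable]: "f \<in> borel_measurable borel"
    using assms by (simp add: square_integrable_def)
  show ?thesis
    using assms by (simp add: square_integrable_def power_mult_distrib)
qed

lemma square_integrable_inner:
  assumes "square_integrable f" "square_integrable g"
  shows "integrable lborel (\<lambda>x. f x \<bullet> g x)"
proof -
  have [measurable]: "f \<in> borel_measurable borel" "g \<in> borel_measurable borel"
    using assms by (simp_all add: square_integrable_def)
  have *: "\<bar>f x \<bullet> g x\<bar> \<le> (norm (f x))\<^sup>2 + (norm (g x))\<^sup>2" for x
  proof -
    have "2 * \<bar>f x \<bullet> g x\<bar> \<le> 2 * norm (f x) * norm (g x)"
      using Cauchy_Schwarz_ineq2[of "f x" "g x"] by simp
    also have "\<dots> \<le> (norm (f x))\<^sup>2 + (norm (g x))\<^sup>2"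
      by (rule sum_squares_bound)
    finally show ?thesis
      by (smt (verit) zero_le_power2)
  qed
  have "integrable lborel (\<lambda>x. (norm (f x))\<^sup>2 + (norm (g x))\<^sup>2)"
    using assms by (simp add: square_integrable_def)
  then show ?thesis
    by (rule Bochner_Integration.integrable_bound) (use * in auto)
qed

definition L2_rel ::
    "('a::euclidean_space \<Rightarrow> 'b::euclidean_space) \<Rightarrow> ('a \<Rightarrow> 'b) \<Rightarrow> bool" where
  "L2_rel f g \<longleftrightarrow> square_integrable f \<and> square_integrable g \<and> (AE x in lborel. f x = g x)"

lemma part_equivp_L2_rel: "part_equivp L2_rel"
proof (rule part_equivpI)
  show "\<exists>f. L2_rel f f"
    by (rule exI[of _ "\<lambda>x. 0"]) (simp add: L2_rel_def square_integrable_zero)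
  show "symp L2_rel"
    by (auto simp: symp_def L2_rel_def)
  show "transp L2_rel"
    unfolding transp_def L2_rel_def by (auto elim: AE_mp)
qed

quotient_type (overloaded) ('a, 'b) L2 =
    "'a::euclidean_space \<Rightarrow> 'b::euclidean_space" / partial: L2_rel
  by (rule part_equivp_L2_rel)

instantiation L2 :: (euclidean_space, euclidean_space) real_inner
begin

lift_definition zero_L2 :: "('a, 'b) L2" is "\<lambda>x. 0"
  by (simp add: L2_rel_def square_integrable_zero)

lift_definition plus_L2 :: "('a, 'b) L2 \<Rightarrow> ('a, 'b) L2 \<Rightarrow> ('a, 'b) L2" is "\<lambda>f g x. f x + g x"
  by (auto simp: L2_rel_def intro: square_integrable_add)

lift_definition scaleR_L2 :: "real \<Rightarrow> ('a, 'b) L2 \<Rightarrow> ('a, 'b) L2" is "\<lambda>c f x. c *\<^sub>R f x"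
  by (auto simp: L2_rel_def intro: square_integrable_scaleR)

lift_definition inner_L2 :: "('a, 'b) L2 \<Rightarrow> ('a, 'b) L2 \<Rightarrow> real"
  is "\<lambda>f g. LINT x|lborel. f x \<bullet> g x"
proof -
  fix f f' g g' :: "'a \<Rightarrow> 'b"
  assume "L2_rel f f'" "L2_rel g g'"
  then have m: "f \<in> borel_measurable lborel" "f' \<in> borel_measurable lborel"
      "g \<in> borel_measurable lborel" "g' \<in> borel_measurable lborel"
    and ae: "AE x in lborel. f x = f' x" "AE x in lborel. g x = g' x"
    by (simp_all add: L2_rel_def square_integrable_def)
  show "(LINT x|lborel. f x \<bullet> g x) = (LINT x|lborel. f' x \<bullet> g' x)"
    by (rule integral_cong_AE) (use m ae in auto)
qed

definition uminus_L2 :: "('a, 'b) L2 \<Rightarrow> ('a, 'b) L2" where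
  "uminus_L2 f = (-1) *\<^sub>R f"

definition minus_L2 :: "('a, 'b) L2 \<Rightarrow> ('a, 'b) L2 \<Rightarrow> ('a, 'b) L2" where
  "minus_L2 f g = f + (-1) *\<^sub>R g"

definition norm_L2 :: "('a, 'b) L2 \<Rightarrow> real" where
  "norm_L2 f = sqrt (f \<bullet> f)"

definition sgn_L2 :: "('a, 'b) L2 \<Rightarrow> ('a, 'b) L2" where
  "sgn_L2 f = scaleR (inverse (norm f)) f"

definition dist_L2 :: "('a, 'b) L2 \<Rightarrow> ('a, 'b) L2 \<Rightarrow> real" where
  "dist_L2 f g = norm (f - g)"

definition uniformity_L2 :: "(('a, 'b) L2 \<times> ('a, 'b) L2) filter" where
  "uniformity_L2 = (INF e\<in>{0<..}. principal {(f, g). dist f g < e})"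

definition open_L2 :: "('a, 'b) L2 set \<Rightarrow> bool" where
  "open_L2 U \<longleftrightarrow> (\<forall>f\<in>U. \<forall>\<^sub>F (f', g) in uniformity. f' = f \<longrightarrow> g \<in> U)"

instance
proof
  fix f g h :: "('a, 'b) L2" and a b :: real
  show "f + g + h = f + (g + h)"
    by transfer (auto simp: L2_rel_def add.assoc intro!: square_integrable_add)
  show "f + g = g + f"
    by transfer (auto simp: L2_rel_def add.commute intro!: square_integrable_add)
  show "0 + f = f"
    by transfer (auto simp: L2_rel_def)
  show "- f + f = 0"
    unfolding uminus_L2_def
    by transfer (auto simp: L2_rel_def square_integrable_zero)
  show "f - g = f + - g"
    by (simp add: minus_L2_def uminus_L2_def)
  show "a *\<^sub>R (f + g) = a *\<^sub>R f + a *\<^sub>R g"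
    by transfer (auto simp: L2_rel_def scaleR_add_right
        intro!: square_integrable_add square_integrable_scaleR)
  show "(a + b) *\<^sub>R f = a *\<^sub>R f + b *\<^sub>R f"
    by transfer (auto simp: L2_rel_def scaleR_add_left
        intro!: square_integrable_add square_integrable_scaleR)
  show "a *\<^sub>R b *\<^sub>R f = (a * b) *\<^sub>R f"
    by transfer (auto simp: L2_rel_def intro!: square_integrable_scaleR)
  show "1 *\<^sub>R f = f"
    by transfer (auto simp: L2_rel_def)
  show "dist f g = norm (f - g)"
    by (rule dist_L2_def)
  show "sgn f = scaleR (inverse (norm f)) f"
    by (rule sgn_L2_def)
  show "(uniformity :: (('a, 'b) L2 \<times> ('a, 'b) L2) filter)
      = (INF e\<in>{0<..}. principal {(f, g). dist f g < e})"
    by (rule uniformity_L2_def)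
  show "open U \<longleftrightarrow> (\<forall>f\<in>U. \<forall>\<^sub>F (f', g) in uniformity. f' = f \<longrightarrow> g \<in> U)"
    for U :: "('a, 'b) L2 set"
    by (rule open_L2_def)
  show "f \<bullet> g = g \<bullet> f"
    by transfer (simp add: inner_commute)
  show "(f + g) \<bullet> h = f \<bullet> h + g \<bullet> h"
    by transfer (simp add: L2_rel_def inner_add_left square_integrable_inner)
  show "a *\<^sub>R f \<bullet> g = a * (f \<bullet> g)"
    by transfer simp
  show "0 \<le> f \<bullet> f"
    by transfer simp
  show "f \<bullet> f = 0 \<longleftrightarrow> f = 0"
  proof transfer
    fix f :: "'a \<Rightarrow> 'b"
    assume f: "L2_rel f f"
    then have "(LINT x|lborel. f x \<bullet> f x) = 0 \<longleftrightarrow> (AE x in lborel. f x \<bullet> f x = 0)"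
      by (intro integral_nonneg_eq_0_iff_AE square_integrable_inner) (auto simp: L2_rel_def)
    then show "(LINT x|lborel. f x \<bullet> f x) = 0 \<longleftrightarrow> L2_rel f (\<lambda>x. 0)"
      using f by (simp add: L2_rel_def square_integrable_zero)
  qed
  show "norm f = sqrt (f \<bullet> f)"
    by (rule norm_L2_def)
qed

end

text \<open>The space \<open>L\<^sup>2(\<Omega>)\<close>, identified with the subspace of those classes on the whole space
  that vanish almost everywhere outside \<open>\<Omega>\<close>. The values are real: the Dirichlet Laplacian commutes
  with complex conjugation, so the trace of its semigroup is the same over both scalar fields.\<close>

definition L2_on :: "'a::euclidean_space set \<Rightarrow> ('a, 'b::euclidean_space) L2 set" where
  "L2_on \<Omega> = {abs_L2 f | f. square_integrable f \<and> (AE x in lborel. x \<notin> \<Omega> \<longrightarrow> f x = 0)}"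


section \<open>The Dirichlet Laplacian\<close>

fun iter_partial :: "'a::euclidean_space list \<Rightarrow> ('a \<Rightarrow> real) \<Rightarrow> 'a \<Rightarrow> real" where
  "iter_partial [] f = f"
| "iter_partial (i # is) f = (\<lambda>x. frechet_derivative (iter_partial is f) (at x) i)"

text \<open>Differentiability of a partial derivative of some order makes it continuous, so this is the
  class of functions all of whose partial derivatives of all orders exist and are continuous.\<close>

definition smooth :: "('a::euclidean_space \<Rightarrow> real) \<Rightarrow> bool" where
  "smooth f \<longleftrightarrow> (\<forall>is. set is \<subseteq> Basis \<longrightarrow> (\<forall>x. iter_partial is f differentiable (at x)))"

definition test_function :: "'a::euclidean_space set \<Rightarrow> ('a \<Rightarrow> real) \<Rightarrow> bool" where
  "test_function \<Omega> \<phi> \<longleftrightarrow>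
     smooth \<phi> \<and> compact (closure {x. \<phi> x \<noteq> 0}) \<and> closure {x. \<phi> x \<noteq> 0} \<subseteq> \<Omega>"

text \<open>Unbounded operators are represented by their graphs. The norm of the product space restricted
  to pairs \<open>(\<phi>, \<nabla>\<phi>)\<close> is the \<open>H\<^sup>1\<close> norm of \<open>\<phi>\<close>, so the domain of the following closed operator is
  \<open>H\<^sup>1\<^sub>0(\<Omega>)\<close>, the closure of the test functions in \<open>H\<^sup>1(\<Omega>)\<close>, and the operator maps
  \<open>u \<in> H\<^sup>1\<^sub>0(\<Omega>)\<close> to its weak gradient.\<close>

definition dirichlet_gradient ::
    "'a::euclidean_space set \<Rightarrow> (('a, real) L2 \<times> ('a, 'a) L2) set" where
  "dirichlet_gradient \<Omega> =
     closure {(abs_L2 \<phi>, abs_L2 p) | \<phi> p. test_function \<Omega> \<phi> \<and> (\<forall>x. GDERIV \<phi> x :> p x)}"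

text \<open>The operator associated with the Dirichlet form: \<open>w = \<Delta>\<^sub>D u\<close> iff \<open>u \<in> H\<^sup>1\<^sub>0(\<Omega>)\<close>,
  \<open>w \<in> L\<^sup>2(\<Omega>)\<close> and \<open>\<integral> \<nabla>u \<bullet> \<nabla>v = - \<integral> w v\<close> for all \<open>v \<in> H\<^sup>1\<^sub>0(\<Omega>)\<close>.\<close>

definition dirichlet_laplacian ::
    "'a::euclidean_space set \<Rightarrow> (('a, real) L2 \<times> ('a, real) L2) set" where
  "dirichlet_laplacian \<Omega> =
     {(u, w). w \<in> L2_on \<Omega> \<and>
        (\<exists>p. (u, p) \<in> dirichlet_gradient \<Omega> \<and>
             (\<forall>(v, q) \<in> dirichlet_gradient \<Omega>. p \<bullet> q = - (w \<bullet> v)))}"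


section \<open>The heat semigroup and its trace\<close>

text \<open>The graph of the operator \<open>e\<^sup>t\<^sup>A\<close> on the closed subspace \<open>H\<close> that is generated by an operator
  \<open>A\<close> given by its graph: \<open>f \<in> H\<close> is mapped to the value at time \<open>t\<close> of the solution of the abstract
  Cauchy problem \<open>u' = A u\<close> on \<open>(0, \<infinity>)\<close>, \<open>u(0) = f\<close>, with \<open>u\<close> continuous on \<open>[0, \<infinity>)\<close>. For \<open>A\<close>
  self-adjoint and nonpositive on \<open>H\<close> the solution exists and is unique for every \<open>f \<in> H\<close>.\<close>

definition semigroup_graph ::
    "'h::real_inner set \<Rightarrow> ('h \<times> 'h) set \<Rightarrow> real \<Rightarrow> ('h \<times> 'h) set" where
  "semigroup_graph H A t =
     {(f, u t) | f u. u 0 = f \<and> (\<forall>s\<ge>0. u s \<in> H) \<and> continuous_on {0..} u \<and>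
        (\<forall>s>0. \<exists>w. (u s, w) \<in> A \<and> (u has_vector_derivative w) (at s))}"

definition orthonormal_basis_of :: "'h::real_inner set \<Rightarrow> 'h set \<Rightarrow> bool" where
  "orthonormal_basis_of H B \<longleftrightarrow>
     pairwise orthogonal B \<and> (\<forall>e\<in>B. norm e = 1) \<and> closure (span B) = H"

text \<open>The trace on \<open>H\<close> of the operator with graph \<open>T\<close>: the common value, for all orthonormal bases
  \<open>B\<close> of \<open>H\<close>, of the sum of \<open>\<langle>e, T e\<rangle>\<close> over \<open>e \<in> B\<close>.\<close>

definition operator_trace :: "'h::real_inner set \<Rightarrow> ('h \<times> 'h) set \<Rightarrow> real" where
  "operator_trace H T =
     (THE r. \<forall>B g. orthonormal_basis_of H B \<and> (\<forall>e\<in>B. (e, g e) \<in> T) \<longrightarrow>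
        ((\<lambda>e. e \<bullet> g e) has_sum r) B)"

definition partition_function :: "'a::euclidean_space set \<Rightarrow> real \<Rightarrow> real" where
  "partition_function \<Omega> t =
     operator_trace (L2_on \<Omega>) (semigroup_graph (L2_on \<Omega>) (dirichlet_laplacian \<Omega>) t)"

end

theory Submission
  imports Defs
begin

text \<open>The normalised dilation \<open>(D\<^sub>c f)(x) = |c|\<^bsup>d/2\<^esup> f(c x)\<close> is unitary on \<open>L\<^sup>2\<close> and maps test functions on
  \<open>\<Omega>\<close> to test functions on \<open>c\<^sup>-\<^sup>1\<Omega>\<close>. Since \<open>\<nabla> (D\<^sub>c \<phi>) = c D\<^sub>c (\<nabla>\<phi>)\<close>, it conjugates the Dirichlet
  Laplacian on \<open>\<Omega>\<close> to \<open>c\<^sup>-\<^sup>2\<close> times the one on \<open>c\<^sup>-\<^sup>1\<Omega>\<close>, hence the heat semigroup at time \<open>t\<close> to the one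
  at time \<open>t / c\<^sup>2\<close>. A unitary conjugation permutes the orthonormal bases, so the traces agree.\<close>

section \<open>Dilations on the space of square-integrable functions\<close>

text \<open>Lebesgue measure is a positive constant times its own image under scaling by a nonzero
  factor, so scaling pulls null sets back to null sets.\<close>

lemma AE_lborel_scaleR:
  fixes c :: real
  assumes "c \<noteq> 0" and "AE x::'a::euclidean_space in lborel. P x"
  shows "AE x in lborel. P (c *\<^sub>R x)"
proof -
  have "AE x in density (distr lborel borel (\<lambda>x::'a. c *\<^sub>R x)) (\<lambda>_. \<bar>c\<bar> ^ DIM('a)). P x"
    using assms(2) by (simp only: lborel_affine[OF assms(1), of "0::'a", unfolded add_0, symmetric])
  then have "AE x in distr lborel borel (\<lambda>x::'a. c *\<^sub>R x). P x"
    using assms(1) by (subst (asm) AE_density) auto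
  then show ?thesis
    by (rule AE_distrD[rotated]) simp
qed

lemma
  fixes f :: "'a::euclidean_space \<Rightarrow> 'b::euclidean_space" and c :: real
  assumes "c \<noteq> 0" and [measurable]: "f \<in> borel_measurable borel"
  shows integrable_lborel_scaleR_iff:
      "integrable lborel (\<lambda>x. f (c *\<^sub>R x)) \<longleftrightarrow> integrable lborel f"
    and integral_lborel_scaleR:
      "\<bar>c\<bar> ^ DIM('a) *\<^sub>R (LINT x|lborel. f (c *\<^sub>R x)) = (LINT x|lborel. f x)"
proof -
  have *: "lborel = density (distr lborel borel (\<lambda>x::'a. c *\<^sub>R x)) (\<lambda>_. ennreal (\<bar>c\<bar> ^ DIM('a)))"
    using lborel_affine[OF assms(1), of "0::'a"] by simp
  show "integrable lborel (\<lambda>x. f (c *\<^sub>R x)) \<longleftrightarrow> integrable lborel f"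
  proof -
    \<comment> \<open>Only the left \<open>lborel\<close> is rewritten as a density over the image
      measure. Its constant weight becomes the scalar factor, which is cancelled afterwards since c
      is nonzero.\<close>
    have "integrable lborel f \<longleftrightarrow> integrable lborel (\<lambda>x. \<bar>c\<bar> ^ DIM('a) *\<^sub>R f (c *\<^sub>R x))"
      by (subst *) (simp add: integrable_density integrable_distr_eq)
    moreover have "integrable lborel (\<lambda>x. f (c *\<^sub>R x))"
      if "integrable lborel (\<lambda>x. \<bar>c\<bar> ^ DIM('a) *\<^sub>R f (c *\<^sub>R x))"
      using integrable_scaleR_right[OF that, of "inverse (\<bar>c\<bar> ^ DIM('a))"] assms(1) by simp
    ultimately show ?thesis
      by (auto intro: integrable_scaleR_right)
  qed
  show "\<bar>c\<bar> ^ DIM('a) *\<^sub>R (LINT x|lborel. f (c *\<^sub>R x)) = (LINT x|lborel. f x)"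
    by (subst (2) *) (simp add: integral_density integral_distr)
qed

text \<open>The prefactor is the square root of the Jacobian of x |-> c x, which makes the map
  isometric on L2 for nonzero c. As the dimension is positive, c = 0 gives the zero function, so the
  lift to \<open>L2\<close> makes sense for every c.\<close>

definition dilate :: "real \<Rightarrow> ('a::euclidean_space \<Rightarrow> 'b::euclidean_space) \<Rightarrow> 'a \<Rightarrow> 'b" where
  "dilate c f = (\<lambda>x. sqrt (\<bar>c\<bar> ^ DIM('a)) *\<^sub>R f (c *\<^sub>R x))"

lemma dilate_0: "dilate 0 f = (\<lambda>x. 0)"
  by (simp add: dilate_def zero_power)

lemma square_integrable_dilate:
  assumes "square_integrable f"
  shows "square_integrable (dilate c f)"
proof (cases "c = 0")
  case False
  have [measurable]: "f \<in> borel_measurable borel"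
    using assms by (simp add: square_integrable_def)
  have "integrable lborel (\<lambda>x. (norm (f (c *\<^sub>R x)))\<^sup>2)"
    using assms integrable_lborel_scaleR_iff[OF False, of "\<lambda>x. (norm (f x))\<^sup>2"]
    by (simp add: square_integrable_def)
  then have "square_integrable (\<lambda>x. f (c *\<^sub>R x))"
    by (simp add: square_integrable_def)
  then show ?thesis
    unfolding dilate_def by (rule square_integrable_scaleR)
qed (simp add: dilate_0 square_integrable_zero)

lift_definition dilate_L2 :: "real \<Rightarrow> ('a::euclidean_space, 'b::euclidean_space) L2 \<Rightarrow> ('a, 'b) L2"
  is dilate
proof -
  fix c and f g :: "'a \<Rightarrow> 'b"
  assume fg: "L2_rel f g"
  have "AE x in lborel. dilate c f x = dilate c g x"
  proof (cases "c = 0")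
    case False
    have "AE x in lborel. f (c *\<^sub>R x) = g (c *\<^sub>R x)"
      using fg by (intro AE_lborel_scaleR[OF False]) (simp add: L2_rel_def)
    then show ?thesis
      by (auto simp: dilate_def)
  qed (simp add: dilate_0)
  then show "L2_rel (dilate c f) (dilate c g)"
    using fg by (simp add: L2_rel_def square_integrable_dilate)
qed

lemma dilate_L2_abs:
  assumes "square_integrable f"
  shows "dilate_L2 c (abs_L2 f) = abs_L2 (dilate c f)"
  by (rule dilate_L2.abs_eq) (use assms in \<open>simp add: L2_rel_def\<close>)

lemma dilate_L2_add: "dilate_L2 c (f + g) = dilate_L2 c f + dilate_L2 c g"
  by transfer
    (auto simp: L2_rel_def dilate_def scaleR_add_right
      intro!: square_integrable_add square_integrable_dilate[unfolded dilate_def])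

lemma dilate_L2_scaleR: "dilate_L2 c (a *\<^sub>R f) = a *\<^sub>R dilate_L2 c f"
proof (transfer fixing: a c)
  fix f :: "'a \<Rightarrow> 'b"
  assume "L2_rel f f"
  moreover have "dilate c (\<lambda>x. a *\<^sub>R f x) = (\<lambda>x. a *\<^sub>R dilate c f x)"
    by (simp add: dilate_def mult.commute)
  ultimately show "L2_rel (dilate c (\<lambda>x. a *\<^sub>R f x)) (\<lambda>x. a *\<^sub>R dilate c f x)"
    by (simp add: L2_rel_def square_integrable_scaleR square_integrable_dilate)
qed

text \<open>The two normalising factors multiply to 1, so the identity holds at every point already
  for representatives.\<close>

lemma dilate_L2_inverse:
  assumes "c \<noteq> 0"
  shows "dilate_L2 (inverse c) (dilate_L2 c f) = f"
proof (transfer fixing: c)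
  fix f :: "'a \<Rightarrow> 'b"
  assume "L2_rel f f"
  moreover have "dilate (inverse c) (dilate c f) = f"
    using assms
    by (simp add: dilate_def real_sqrt_mult[symmetric] power_mult_distrib[symmetric] abs_mult[symmetric])
  ultimately show "L2_rel (dilate (inverse c) (dilate c f)) f"
    by simp
qed

text \<open>The two prefactors multiply to the Jacobian |c|^d, which the change of variables
  absorbs.\<close>

lemma inner_dilate_L2:
  assumes "c \<noteq> 0"
  shows "dilate_L2 c f \<bullet> dilate_L2 c g = f \<bullet> g"
proof (transfer fixing: c)
  fix f g :: "'a \<Rightarrow> 'b"
  assume "L2_rel f f" "L2_rel g g"
  then have [measurable]: "f \<in> borel_measurable borel" "g \<in> borel_measurable borel"
    by (simp_all add: L2_rel_def square_integrable_def)
  have "(LINT x|lborel. dilate c f x \<bullet> dilate c g x)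
      = \<bar>c\<bar> ^ DIM('a) *\<^sub>R (LINT x|lborel. f (c *\<^sub>R x) \<bullet> g (c *\<^sub>R x))"
    by (simp add: dilate_def mult.assoc[symmetric])
  also have "\<dots> = (LINT x|lborel. f x \<bullet> g x)"
    by (rule integral_lborel_scaleR[OF assms, of "\<lambda>x. f x \<bullet> g x"]) simp
  finally show "(LINT x|lborel. dilate c f x \<bullet> dilate c g x) = (LINT x|lborel. f x \<bullet> g x)" .
qed

lemma norm_dilate_L2: "c \<noteq> 0 \<Longrightarrow> norm (dilate_L2 c f) = norm f"
  by (simp add: norm_eq_sqrt_inner inner_dilate_L2)

lemma bounded_linear_dilate_L2:
  assumes "c \<noteq> 0"
  shows "bounded_linear (dilate_L2 c)"
  by (rule bounded_linear_intro[where K = 1])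
    (simp_all add: dilate_L2_add dilate_L2_scaleR norm_dilate_L2 assms)

text \<open>The dilated domain is written as a preimage because x lies outside it exactly when c x
  lies outside \<Omega>; for nonzero c it is the set \<Omega> scaled by 1/c.\<close>

lemma dilate_L2_on:
  assumes "c \<noteq> 0" and "f \<in> L2_on \<Omega>"
  shows "dilate_L2 c f \<in> L2_on ((*\<^sub>R) c -` \<Omega>)"
proof -
  obtain h where h: "f = abs_L2 h" "square_integrable h" "AE x in lborel. x \<notin> \<Omega> \<longrightarrow> h x = 0"
    using assms(2) by (auto simp: L2_on_def)
  have "AE x in lborel. c *\<^sub>R x \<notin> \<Omega> \<longrightarrow> h (c *\<^sub>R x) = 0"
    by (rule AE_lborel_scaleR[OF assms(1) h(3)])
  then have "AE x in lborel. x \<notin> (*\<^sub>R) c -` \<Omega> \<longrightarrow> dilate c h x = 0"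
    by (auto simp: dilate_def)
  then show ?thesis
    using h by (auto simp: L2_on_def dilate_L2_abs square_integrable_dilate)
qed

section \<open>Dilations of test functions\<close>

text \<open>Each partial derivative contributes one factor c by the chain rule. The free constant k
  makes room for the normalisation in \<open>dilate\<close>.\<close>

lemma iter_partial_dilate:
  assumes "\<And>is x. set is \<subseteq> Basis \<Longrightarrow> iter_partial is f differentiable (at x)"
    and "set is \<subseteq> Basis"
  shows "iter_partial is (\<lambda>x. k * f (c *\<^sub>R x)) = (\<lambda>x. (k * c ^ length is) * iter_partial is f (c *\<^sub>R x))"
  using assms(2)
proof (induction "is")
  case (Cons i "is")
  have "frechet_derivative (\<lambda>x. (k * c ^ length is) * iter_partial is f (c *\<^sub>R x)) (at x) i
      = k * c ^ length (i # is) * frechet_derivative (iter_partial is f) (at (c *\<^sub>R x)) i" for x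
  proof -
    let ?D = "frechet_derivative (iter_partial is f) (at (c *\<^sub>R x))"
    have D: "(iter_partial is f has_derivative ?D) (at (c *\<^sub>R x))"
      using assms(1) Cons.prems by (simp add: frechet_derivative_works[symmetric])
    have "((\<lambda>x. iter_partial is f (c *\<^sub>R x)) has_derivative (\<lambda>h. ?D (c *\<^sub>R h))) (at x)"
      by (rule has_derivative_compose[rotated], rule D) (auto intro!: derivative_eq_intros)
    then have "((\<lambda>x. (k * c ^ length is) * iter_partial is f (c *\<^sub>R x)) has_derivative
        (\<lambda>h. (k * c ^ length is) * ?D (c *\<^sub>R h))) (at x)"
      by (rule has_derivative_mult_right)
    from frechet_derivative_at[OF this]
    have "frechet_derivative (\<lambda>x. (k * c ^ length is) * iter_partial is f (c *\<^sub>R x)) (at x) i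
        = (k * c ^ length is) * ?D (c *\<^sub>R i)"
      by metis
    \<comment> \<open>Linearity of the derivative yields the new factor c.\<close>
    also have "?D (c *\<^sub>R i) = c * ?D i"
      using linear_scale[OF has_derivative_linear[OF D], of c i] by simp
    finally show ?thesis
      by simp
  qed
  then show ?case
    using Cons by simp
qed simp

lemma smooth_dilate:
  fixes f :: "'a::euclidean_space \<Rightarrow> real"
  assumes "smooth f"
  shows "smooth (dilate c f)"
  unfolding smooth_def
proof (intro allI impI)
  fix "is" :: "'a list" and x
  assume basis: "set is \<subseteq> Basis"
  let ?k = "sqrt (\<bar>c\<bar> ^ DIM('a))"
  have f: "iter_partial is f differentiable (at x)" if "set is \<subseteq> Basis" for "is" x
    using assms that by (simp add: smooth_def)
  have "(\<lambda>x. iter_partial is f (c *\<^sub>R x)) differentiable (at x)"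
    by (rule differentiable_compose[of _ "\<lambda>x. c *\<^sub>R x"]) (use f[OF basis] in auto)
  then have "(\<lambda>x. (?k * c ^ length is) * iter_partial is f (c *\<^sub>R x)) differentiable (at x)"
    by (intro differentiable_mult differentiable_const)
  moreover have "iter_partial is (dilate c f)
      = (\<lambda>x. (?k * c ^ length is) * iter_partial is f (c *\<^sub>R x))"
    using iter_partial_dilate[OF f basis, of ?k c] by (simp add: dilate_def)
  ultimately show "iter_partial is (dilate c f) differentiable (at x)"
    by simp
qed

text \<open>The support of the dilated function is the old support scaled by 1/c: scaling commutes
  with closure and preserves compactness.\<close>

lemma test_function_dilate:
  fixes \<phi> :: "'a::euclidean_space \<Rightarrow> real"
  assumes "c \<noteq> 0" and "test_function \<Omega> \<phi>"
  shows "test_function ((*\<^sub>R) c -` \<Omega>) (dilate c \<phi>)"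
proof -
  have "{x. dilate c \<phi> x \<noteq> 0} = (*\<^sub>R) (inverse c) ` {x. \<phi> x \<noteq> 0}"
  proof (intro set_eqI iffI)
    fix x
    assume "x \<in> {x. dilate c \<phi> x \<noteq> 0}"
    then show "x \<in> (*\<^sub>R) (inverse c) ` {x. \<phi> x \<noteq> 0}"
      using assms(1) by (intro image_eqI[of _ _ "c *\<^sub>R x"]) (auto simp: dilate_def)
  qed (use assms(1) in \<open>auto simp: dilate_def\<close>)
  then have "closure {x. dilate c \<phi> x \<noteq> 0} = (*\<^sub>R) (inverse c) ` closure {x. \<phi> x \<noteq> 0}"
    by (simp add: closure_scaleR)
  then show ?thesis
    using assms by (auto simp: test_function_def smooth_dilate compact_scaling)
qed

text \<open>Chain rule: the inner derivative is scaling by c, which is self-adjoint and therefore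
  moves onto the gradient.\<close>

lemma GDERIV_dilate:
  assumes "\<And>x. GDERIV \<phi> x :> p x"
  shows "GDERIV (dilate c \<phi>) x :> c *\<^sub>R dilate c p x"
proof -
  have "(\<phi> has_derivative (\<lambda>h. h \<bullet> p (c *\<^sub>R x))) (at (c *\<^sub>R x))"
    using assms by (simp add: gderiv_def)
  then have "((\<lambda>x. \<phi> (c *\<^sub>R x)) has_derivative (\<lambda>h. (c *\<^sub>R h) \<bullet> p (c *\<^sub>R x))) (at x)"
    by (rule has_derivative_compose[rotated]) (auto intro!: derivative_eq_intros)
  then show ?thesis
    unfolding gderiv_def dilate_def
    by (auto intro!: derivative_eq_intros simp: algebra_simps)
qed

section \<open>Square integrability of test functions and their gradients\<close>

lemma square_integrable_continuous_compact_support: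
  fixes f :: "'a::euclidean_space \<Rightarrow> 'b::euclidean_space"
  assumes "continuous_on UNIV f" and "compact K" and "\<And>x. x \<notin> K \<Longrightarrow> f x = 0"
  shows "square_integrable f"
proof -
  have "integrable lborel (\<lambda>x. indicator K x *\<^sub>R (norm (f x))\<^sup>2)"
    by (rule borel_integrable_compact[OF assms(2)])
      (intro continuous_intros continuous_on_subset[OF assms(1)], simp)
  also have "(\<lambda>x. indicator K x *\<^sub>R (norm (f x))\<^sup>2) = (\<lambda>x. (norm (f x))\<^sup>2)"
    by (rule ext) (use assms(3) in \<open>auto simp: indicator_def\<close>)
  finally show ?thesis
    using borel_measurable_continuous_onI[OF assms(1)] by (simp add: square_integrable_def)
qed

text \<open>\<open>dilate_L2_abs\<close> computes with representatives only when they are square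
  integrable; this provides that for the pairs generating the Dirichlet gradient. Both functions are
  continuous and vanish outside the compact support of \<phi>.\<close>

lemma
  fixes \<phi> :: "'a::euclidean_space \<Rightarrow> real"
  assumes \<phi>: "test_function \<Omega> \<phi>" and p: "\<And>x. GDERIV \<phi> x :> p x"
  shows square_integrable_test_function: "square_integrable \<phi>"
    and square_integrable_gradient: "square_integrable p"
proof -
  let ?K = "closure {x. \<phi> x \<noteq> 0}"
  have smooth: "iter_partial is \<phi> differentiable (at x)" if "set is \<subseteq> Basis" for "is" x
    using \<phi> that by (simp add: test_function_def smooth_def)
  have K: "compact ?K"
    using \<phi> by (simp add: test_function_def)
  have zero: "\<phi> x = 0" if "x \<notin> ?K" for x
    using that closure_subset[of "{x. \<phi> x \<noteq> 0}"] by auto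
  have "continuous_on UNIV \<phi>"
    using smooth[of "[]"] by (simp add: continuous_at_imp_continuous_on differentiable_imp_continuous_within)
  then show "square_integrable \<phi>"
    using K zero by (rule square_integrable_continuous_compact_support)
  have D: "(\<phi> has_derivative (\<lambda>h. h \<bullet> p x)) (at x)" for x
    using p by (simp add: gderiv_def)
  have partial: "iter_partial [i] \<phi> = (\<lambda>x. p x \<bullet> i)" for i
    by (simp add: frechet_derivative_at[OF D, symmetric] inner_commute)
  \<comment> \<open>The components of p are the first partial derivatives of \<phi>, and
    \<open>smooth\<close> makes these differentiable, hence continuous.\<close>
  have "continuous_on UNIV (\<lambda>x. p x \<bullet> i)" if "i \<in> Basis" for i
    using smooth[of "[i]"] that unfolding partial
    by (simp add: continuous_at_imp_continuous_on differentiable_imp_continuous_within)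
  then have "continuous_on UNIV p"
    by (subst continuous_on_componentwise) blast
  moreover have "p x = 0" if "x \<notin> ?K" for x
  proof -
    have "(\<phi> has_derivative (\<lambda>h. 0)) (at x)"
    \<comment> \<open>The complement of the support is open and \<phi> is zero on it, so the
      derivative of \<phi> there is that of the zero function.\<close>
    proof (rule has_derivative_transform_within_open[of "\<lambda>_. 0" _ _ _ "- ?K"])
      show "x \<in> - ?K"
        using that by simp
      show "0 = \<phi> y" if "y \<in> - ?K" for y
        using zero[of y] that by simp
    qed (simp_all add: open_Compl)
    then have "(\<lambda>h. h \<bullet> p x) = (\<lambda>h. 0)"
      by (rule has_derivative_unique[OF D])
    then have "p x \<bullet> p x = 0"
      by metis
    then show ?thesis
      by simp
  qed
  ultimately show "square_integrable p"
    using K square_integrable_continuous_compact_support by blast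
qed

section \<open>The Dirichlet Laplacian under dilations\<close>

text \<open>The rule \<nabla>(D_c \<phi>) = c D_c (\<nabla>\<phi>) for test functions passes to the
  closure, because the map acting on pairs is continuous for the product norm.\<close>

lemma dirichlet_gradient_dilate:
  assumes "c \<noteq> 0" and "(u, p) \<in> dirichlet_gradient \<Omega>"
  shows "(dilate_L2 c u, c *\<^sub>R dilate_L2 c p) \<in> dirichlet_gradient ((*\<^sub>R) c -` \<Omega>)"
proof -
  \<comment> \<open>\<open>G \<Omega>\<close> is the gradient graph on test functions, before
    closure.\<close>
  define G :: "'a set \<Rightarrow> (('a, real) L2 \<times> ('a, 'a) L2) set" where
    "G \<Omega> = {(abs_L2 \<phi>, abs_L2 p) | \<phi> p. test_function \<Omega> \<phi> \<and> (\<forall>x. GDERIV \<phi> x :> p x)}" for \<Omega>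
  define F :: "('a, real) L2 \<times> ('a, 'a) L2 \<Rightarrow> ('a, real) L2 \<times> ('a, 'a) L2" where
    "F = (\<lambda>z. (dilate_L2 c (fst z), c *\<^sub>R dilate_L2 c (snd z)))"
  have "F z \<in> G ((*\<^sub>R) c -` \<Omega>)" if z: "z \<in> G \<Omega>" for z
  proof -
    obtain \<phi> p where \<phi>: "z = (abs_L2 \<phi>, abs_L2 p)" "test_function \<Omega> \<phi>" "\<And>x. GDERIV \<phi> x :> p x"
      using z by (auto simp: G_def)
    have sq: "square_integrable \<phi>" "square_integrable p"
      using square_integrable_test_function square_integrable_gradient \<phi>(2,3) by blast+
    have "c *\<^sub>R dilate_L2 c (abs_L2 p) = abs_L2 (\<lambda>x. c *\<^sub>R dilate c p x)"
      using sq(2)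
      by (simp add: dilate_L2_abs scaleR_L2.abs_eq L2_rel_def square_integrable_dilate)
    then have "F z = (abs_L2 (dilate c \<phi>), abs_L2 (\<lambda>x. c *\<^sub>R dilate c p x))"
      using \<phi>(1) sq(1) by (simp add: F_def dilate_L2_abs)
    then show ?thesis
      using test_function_dilate[OF assms(1) \<phi>(2)] GDERIV_dilate[OF \<phi>(3)] by (auto simp: G_def)
  qed
  moreover have "continuous_on UNIV F"
    unfolding F_def
    by (intro continuous_intros bounded_linear.continuous_on[OF bounded_linear_dilate_L2[OF assms(1)]])
  ultimately have "F ` closure (G \<Omega>) \<subseteq> closure (G ((*\<^sub>R) c -` \<Omega>))"
    by (intro image_closure_subset) (auto intro: continuous_on_subset closure_subset[THEN subsetD])
  then have "F (u, p) \<in> closure (G ((*\<^sub>R) c -` \<Omega>))"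
    using assms(2) by (auto simp: dirichlet_gradient_def G_def)
  then show ?thesis
    by (simp add: dirichlet_gradient_def G_def F_def)
qed

lemma vimage_scaleR_inverse:
  fixes S :: "'a::real_vector set"
  assumes "c \<noteq> 0"
  shows "(*\<^sub>R) (inverse c) -` ((*\<^sub>R) c -` S) = S"
  using assms by auto

text \<open>The weak equation is checked against a pair (v, q) on the dilated domain by pulling the
  pair back to \<Omega>. One factor c comes from the gradient of u and one from that of v, which
  explains the square.\<close>

lemma dirichlet_laplacian_dilate:
  assumes c: "c \<noteq> 0" and uw: "(u, w) \<in> dirichlet_laplacian \<Omega>"
  shows "(dilate_L2 c u, c\<^sup>2 *\<^sub>R dilate_L2 c w) \<in> dirichlet_laplacian ((*\<^sub>R) c -` \<Omega>)"
proof -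
  obtain p where w: "w \<in> L2_on \<Omega>" and p: "(u, p) \<in> dirichlet_gradient \<Omega>"
    and form: "\<And>v q. (v, q) \<in> dirichlet_gradient \<Omega> \<Longrightarrow> p \<bullet> q = - (w \<bullet> v)"
    using uw by (auto simp: dirichlet_laplacian_def)
  have "(c *\<^sub>R dilate_L2 c p) \<bullet> q = - ((c\<^sup>2 *\<^sub>R dilate_L2 c w) \<bullet> v)"
    if vq: "(v, q) \<in> dirichlet_gradient ((*\<^sub>R) c -` \<Omega>)" for v q
  proof -
    let ?v = "dilate_L2 (inverse c) v" and ?q = "inverse c *\<^sub>R dilate_L2 (inverse c) q"
    have "(?v, ?q) \<in> dirichlet_gradient \<Omega>"
      using dirichlet_gradient_dilate[OF _ vq, of "inverse c"] c by (simp add: vimage_scaleR_inverse)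
    then have "p \<bullet> ?q = - (w \<bullet> ?v)"
      by (rule form)
    moreover have "v = dilate_L2 c ?v" "q = c *\<^sub>R dilate_L2 c ?q"
      using c by (simp_all add: dilate_L2_scaleR dilate_L2_inverse[of "inverse c", simplified])
    \<comment> \<open>With D_c preserving inner products, <c D_c p, q> = c^2 <p, \<open>?q\<close>>
      = - c^2 <w, \<open>?v\<close>> = - <c^2 D_c w, v>.\<close>
    ultimately show ?thesis
      using c by (metis (no_types, lifting) inner_dilate_L2 inner_scaleR_left inner_scaleR_right
          mult.assoc mult_minus_right power2_eq_square)
  qed
  moreover have "c\<^sup>2 *\<^sub>R dilate_L2 c w \<in> L2_on ((*\<^sub>R) c -` \<Omega>)"
  proof -
    have "c\<^sup>2 *\<^sub>R w \<in> L2_on \<Omega>"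
    proof -
      obtain h where "w = abs_L2 h" "square_integrable h" "AE x in lborel. x \<notin> \<Omega> \<longrightarrow> h x = 0"
        using w by (auto simp: L2_on_def)
      then show ?thesis
        by (auto simp: L2_on_def scaleR_L2.abs_eq L2_rel_def
            intro!: exI[of _ "\<lambda>x. c\<^sup>2 * h x"] square_integrable_scaleR[where 'b = real, simplified])
    qed
    then show ?thesis
      using dilate_L2_on[OF c] by (metis dilate_L2_scaleR)
  qed
  ultimately show ?thesis
    using dirichlet_gradient_dilate[OF c p] by (auto simp: dirichlet_laplacian_def)
qed

text \<open>If u solves the heat equation on \<Omega>, then v(s) = D_c u(c^2 s) solves it on the
  dilated domain: the factor c^2 from differentiating in time matches the one in the dilated
  Laplacian. At time t / c^2 it takes the value D_c u(t).\<close>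

lemma heat_semigroup_dilate:
  assumes c: "c \<noteq> 0"
    and fg: "(f, g) \<in> semigroup_graph (L2_on \<Omega>) (dirichlet_laplacian \<Omega>) t"
  shows "(dilate_L2 c f, dilate_L2 c g)
    \<in> semigroup_graph (L2_on ((*\<^sub>R) c -` \<Omega>)) (dirichlet_laplacian ((*\<^sub>R) c -` \<Omega>)) (t / c\<^sup>2)"
proof -
  obtain u where u: "u 0 = f" "u t = g" "\<And>s. s \<ge> 0 \<Longrightarrow> u s \<in> L2_on \<Omega>" "continuous_on {0..} u"
    and sol: "\<And>s. s > 0 \<Longrightarrow> \<exists>w. (u s, w) \<in> dirichlet_laplacian \<Omega> \<and> (u has_vector_derivative w) (at s)"
    using fg by (auto simp: semigroup_graph_def)
  define v where "v s = dilate_L2 c (u (c\<^sup>2 * s))" for s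
  have "v 0 = dilate_L2 c f" "v (t / c\<^sup>2) = dilate_L2 c g"
    using c u by (simp_all add: v_def)
  moreover have "v s \<in> L2_on ((*\<^sub>R) c -` \<Omega>)" if "s \<ge> 0" for s
    using that u(3) by (simp add: v_def dilate_L2_on[OF c])
  moreover have "continuous_on {0..} v"
    unfolding v_def
    by (intro bounded_linear.continuous_on[OF bounded_linear_dilate_L2[OF c]]
        continuous_on_compose2[OF u(4)] continuous_intros) auto
  moreover have "\<exists>w. (v s, w) \<in> dirichlet_laplacian ((*\<^sub>R) c -` \<Omega>) \<and> (v has_vector_derivative w) (at s)"
    if "s > 0" for s
  proof -
    obtain w where w: "(u (c\<^sup>2 * s), w) \<in> dirichlet_laplacian \<Omega>"
        "(u has_vector_derivative w) (at (c\<^sup>2 * s))"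
      using sol[of "c\<^sup>2 * s"] mult_pos_pos[of "c\<^sup>2" s] c \<open>s > 0\<close> by auto
    have "((\<lambda>s. c\<^sup>2 * s) has_vector_derivative c\<^sup>2) (at s)"
      by (auto intro!: derivative_eq_intros simp: has_real_derivative_iff_has_vector_derivative[symmetric])
    from vector_diff_chain_at[OF this w(2)]
    have "((\<lambda>s. u (c\<^sup>2 * s)) has_vector_derivative c\<^sup>2 *\<^sub>R w) (at s)"
      by (simp add: o_def)
    from bounded_linear.has_vector_derivative[OF bounded_linear_dilate_L2[OF c] this]
    have "(v has_vector_derivative c\<^sup>2 *\<^sub>R dilate_L2 c w) (at s)"
      by (simp add: v_def[abs_def] dilate_L2_scaleR)
    then show ?thesis
      using dirichlet_laplacian_dilate[OF c w(1)] by (auto simp: v_def)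
  qed
  ultimately show ?thesis
    unfolding semigroup_graph_def by (auto intro!: exI[of _ v])
qed

section \<open>Unitary invariance of the trace\<close>

text \<open>Orthonormality is immediate from preservation of inner products. The point is density of
  the span, for which U has to commute with closure.\<close>

lemma orthonormal_basis_of_isometry:
  assumes U: "bounded_linear U" "\<And>x y. U x \<bullet> U y = x \<bullet> y" and V: "bounded_linear V" "\<And>x. U (V x) = x"
    and UH: "U ` H = H'" and B: "orthonormal_basis_of H B"
  shows "orthonormal_basis_of H' (U ` B)"
proof -
  have "closure (span (U ` B)) = closure (U ` span B)"
    by (simp add: linear_span_image bounded_linear.linear[OF U(1)])
  also have "\<dots> = U ` closure (span B)"
  proof (intro subset_antisym closure_minimal)
    \<comment> \<open>An isometry is injective, so the right inverse V is also a left inverse.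
      Images under U are thus preimages under the continuous map V, and closed sets have closed
      images.\<close>
    have "V (U x) = x" for x
    proof -
      have "U (V (U x) - x) = 0"
        using U(1) V(2) by (simp add: linear_diff bounded_linear.linear)
      then have "(V (U x) - x) \<bullet> (V (U x) - x) = 0"
        using U(2)[of "V (U x) - x" "V (U x) - x"] by simp
      then show ?thesis
        by simp
    qed
    then have "U ` closure (span B) = V -` closure (span B)"
      using V(2) by (auto simp: image_iff) metis
    then show "closed (U ` closure (span B))"
      using continuous_closed_vimage[OF closed_closure, of V]
        linear_continuous_at[OF V(1)] by simp
    show "U ` span B \<subseteq> U ` closure (span B)"
      by (intro image_mono closure_subset)
    show "U ` closure (span B) \<subseteq> closure (U ` span B)"
      by (intro image_closure_subset linear_continuous_on[OF U(1)] closed_closure closure_subset)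
  qed
  also have "\<dots> = H'"
    using B UH by (simp add: orthonormal_basis_of_def)
  finally have "closure (span (U ` B)) = H'" .
  then show ?thesis
    using B by (auto simp: orthonormal_basis_of_def pairwise_def orthogonal_def U(2) norm_eq_sqrt_inner)
qed

lemma trace_sum_isometry:
  assumes U: "bounded_linear U" "\<And>x y. U x \<bullet> U y = x \<bullet> y" and V: "bounded_linear V"
    and UV: "\<And>x. U (V x) = x" and VU: "\<And>x. V (U x) = x"
    and UH: "U ` H = H'" and T: "\<forall>(x, y)\<in>T'. (V x, V y) \<in> T"
    and r: "\<forall>B g. orthonormal_basis_of H B \<and> (\<forall>e\<in>B. (e, g e) \<in> T) \<longrightarrow> ((\<lambda>e. e \<bullet> g e) has_sum r) B"
    and B: "orthonormal_basis_of H' B" and g: "\<forall>e\<in>B. (e, g e) \<in> T'"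
  shows "((\<lambda>e. e \<bullet> g e) has_sum r) B"
proof -
  have VV: "V x \<bullet> V y = x \<bullet> y" for x y
    using U(2)[of "V x" "V y"] by (simp add: UV)
  have "V ` H' = H"
    unfolding UH[symmetric] by (simp add: image_image VU)
  then have "orthonormal_basis_of H (V ` B)"
    using orthonormal_basis_of_isometry[OF V VV U(1) VU _ B] by simp
  moreover have "\<forall>e\<in>V ` B. (e, V (g (U e))) \<in> T"
    using g T by (auto simp: UV)
  ultimately have "((\<lambda>e. e \<bullet> V (g (U e))) has_sum r) (V ` B)"
    using r by (elim allE[of _ "V ` B"] allE[of _ "\<lambda>e. V (g (U e))"]) simp
  \<comment> \<open>Injectivity permits reindexing the sum from the pulled-back basis to B.\<close>
  moreover have "inj_on V B"
    by (rule inj_on_inverseI[of _ U]) (rule UV)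
  ultimately show ?thesis
    by (simp add: has_sum_reindex o_def UV VV)
qed

text \<open>The trace is a definite description, so it suffices that the predicates on r for the two
  operators are equivalent. Each implication is \<open>trace_sum_isometry\<close>.\<close>

lemma operator_trace_isometry:
  assumes U: "bounded_linear U" "\<And>x y. U x \<bullet> U y = x \<bullet> y" and V: "bounded_linear V"
    and UV: "\<And>x. U (V x) = x" and VU: "\<And>x. V (U x) = x"
    and UH: "U ` H = H'"
    and T: "\<forall>(x, y)\<in>T. (U x, U y) \<in> T'" and T': "\<forall>(x, y)\<in>T'. (V x, V y) \<in> T"
  shows "operator_trace H' T' = operator_trace H T"
proof -
  have VV: "V x \<bullet> V y = x \<bullet> y" for x y
    using U(2)[of "V x" "V y"] by (simp add: UV)
  have VH: "V ` H' = H"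
    unfolding UH[symmetric] by (simp add: image_image VU)
  show ?thesis
    unfolding operator_trace_def
  proof (rule arg_cong[of _ _ The], intro ext iffI allI impI; elim conjE)
    \<comment> \<open>In this direction U and V, and with them the two spaces, exchange their
      roles.\<close>
    fix r B g
    assume "\<forall>B g. orthonormal_basis_of H' B \<and> (\<forall>e\<in>B. (e, g e) \<in> T') \<longrightarrow> ((\<lambda>e. e \<bullet> g e) has_sum r) B"
      "orthonormal_basis_of H B" "\<forall>e\<in>B. (e, g e) \<in> T"
    then show "((\<lambda>e. e \<bullet> g e) has_sum r) B"
      by (rule trace_sum_isometry[OF V VV U(1) VU UV VH T])
  next
    fix r B g
    assume "\<forall>B g. orthonormal_basis_of H B \<and> (\<forall>e\<in>B. (e, g e) \<in> T) \<longrightarrow> ((\<lambda>e. e \<bullet> g e) has_sum r) B"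
      "orthonormal_basis_of H' B" "\<forall>e\<in>B. (e, g e) \<in> T'"
    then show "((\<lambda>e. e \<bullet> g e) has_sum r) B"
      by (rule trace_sum_isometry[OF U V UV VU UH T'])
  qed
qed

section \<open>Parabolic scaling of the partition function\<close>

theorem proposition2p4:
  fixes \<Omega> :: "'a::euclidean_space set" and \<rho> t :: real
  assumes "open \<Omega>" and "bounded \<Omega>" and "\<rho> > 0" and "t > 0"
  shows "partition_function ((\<lambda>x. \<rho> *\<^sub>R x) ` \<Omega>) (\<rho>\<^sup>2 * t) = partition_function \<Omega> t"
proof -
  \<comment> \<open>The factor is 1/\<rho> because \<open>dilate\<close> acts by precomposition: the
    preimage of \<Omega> under scaling by 1/\<rho> is \<rho>\<Omega>, and t / \<open>?c\<close>^2 is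
    \<rho>^2 t.\<close>
  let ?c = "inverse \<rho>" and ?\<Omega>' = "(\<lambda>x. \<rho> *\<^sub>R x) ` \<Omega>"
  have \<rho>: "\<rho> \<noteq> 0" "?c \<noteq> 0"
    using assms(3) by simp_all
  have \<Omega>': "(*\<^sub>R) ?c -` \<Omega> = ?\<Omega>'"
    using \<rho>(1) by (auto simp: image_iff intro!: bexI[of _ "?c *\<^sub>R _"])
  have \<Omega>: "(*\<^sub>R) \<rho> -` ?\<Omega>' = \<Omega>"
    using \<rho>(1) by auto
  have UV: "dilate_L2 ?c (dilate_L2 \<rho> f) = f" for f :: "('a, real) L2"
    by (rule dilate_L2_inverse[OF \<rho>(1)])
  have VU: "dilate_L2 \<rho> (dilate_L2 ?c f) = f" for f :: "('a, real) L2"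
    using dilate_L2_inverse[OF \<rho>(2)] by simp
  have "dilate_L2 ?c ` L2_on \<Omega> = (L2_on ?\<Omega>' :: ('a, real) L2 set)"
  proof (intro subset_antisym subsetI)
    fix f :: "('a, real) L2"
    assume "f \<in> L2_on ?\<Omega>'"
    \<comment> \<open>Surjectivity: dilating back by \<rho> supplies the preimage of f.\<close>
    then have "dilate_L2 \<rho> f \<in> L2_on \<Omega>"
      using dilate_L2_on[OF \<rho>(1)] \<Omega> by metis
    then show "f \<in> dilate_L2 ?c ` L2_on \<Omega>"
      using UV by (metis image_eqI)
  qed (use dilate_L2_on[OF \<rho>(2), of _ \<Omega>] in \<open>auto simp: \<Omega>'\<close>)
  then show ?thesis
    unfolding partition_function_def
  proof (rule operator_trace_isometry[OF bounded_linear_dilate_L2[OF \<rho>(2)] inner_dilate_L2[OF \<rho>(2)]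
        bounded_linear_dilate_L2[OF \<rho>(1)] UV VU]; clarify)
    fix f g :: "('a, real) L2"
    show "(dilate_L2 ?c f, dilate_L2 ?c g)
        \<in> semigroup_graph (L2_on ?\<Omega>') (dirichlet_laplacian ?\<Omega>') (\<rho>\<^sup>2 * t)"
      if "(f, g) \<in> semigroup_graph (L2_on \<Omega>) (dirichlet_laplacian \<Omega>) t"
      using heat_semigroup_dilate[OF \<rho>(2) that] \<Omega>' by (simp add: field_simps)
    show "(dilate_L2 \<rho> f, dilate_L2 \<rho> g)
        \<in> semigroup_graph (L2_on \<Omega>) (dirichlet_laplacian \<Omega>) t"
      if "(f, g) \<in> semigroup_graph (L2_on ?\<Omega>') (dirichlet_laplacian ?\<Omega>') (\<rho>\<^sup>2 * t)"
      using heat_semigroup_dilate[OF \<rho>(1) that] \<Omega> \<rho>(1) by simp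
  qed
qed

end
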